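(* Suppose that $\sum_{n=0}^\infty a_n^{-1}<\infty$, that $\beta_n\to\beta_\infty$ as $n\to\infty$ with $|\beta_\infty|<1$, that $\sum_n |k_n-1|<\infty$, and that $\sum_n|\beta_{n+1}-\beta_n|<\infty$. If $\lambda\in\mathbb R$, then $$P_n(\lambda)=2a_n^{-1/2}\Big(\kappa(\lambda)\cos\big(\phi_n-\eta(\lambda)\big)+O(\varepsilon_n)\Big),\qquad n\to\infty .$$ This asymptotics is uniform in $\lambda$ from compact subsets of $\mathbb R$.
   Context: $\mathbb Z_+=\{0,1,2,\dots\}$. The coefficients satisfy $a_n>0$, $b_n\in\mathbb R$ for $n\in\mathbb Z_+$, and by convention $a_{-1}=1/2$. Notation: $$\beta_n=-\frac{b_n}{2\sqrt{a_{n-1}a_n}},\qquad \alpha_n=\frac1{2\sqrt{a_{n-1}a_n}},\qquad k_n=\frac{a_n}{\sqrt{a_{n-1}a_{n+1}}}.$$ The phase is $\phi_n=\sum_{m}\arccos\beta_m$, the sum being over those $m\in\{0,\dots,n-1\}$ with $|\beta_m|\le1$ ($\arccos$ takes values in $[0,\pi]$). The remainder (with $z=\lambda$) is $$\varepsilon_n=\sum_{m=n+1}^\infty\big(|\beta_{m-1}-\beta_m|+|k_m-1|+\alpha_m|z|\big).$$ The Jacobi equation is $a_{n-1}F_{n-1}+b_nF_n+a_nF_{n+1}=zF_n$, $n\in\mathbb Z_+$, for sequences $(F_n)_{n\ge-1}$. The orthogonal polynomials $P_n(z)$ are its solution with $P_{-1}(z)=0$, $P_0(z)=1$. The Jost solution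 $f_n(z)$ is its unique solution with $f_n(z)=a_n^{-1/2}e^{-i\phi_n}(1+o(1))$ as $n\to\infty$, and $\tilde f_n(z)=\overline{f_n(\bar z)}$ is the conjugate Jost solution; $f(z)$ and $\tilde f(z)$ are linearly independent solutions. Let $k_\pm(z)$ be the coefficients (not to be confused with $k_n$) in $P_n(z)=k_+(z)f_n(z)+k_-(z)\tilde f_n(z)$. Set $\kappa(z)=|k_+(z)|$ and define $\eta(z)\in\mathbb R/2\pi\mathbb Z$ by $k_+(z)=\kappa(z)e^{i\eta(z)}$. *)

theory Defs
  imports "HOL-Analysis.Analysis" "HOL-Library.Landau_Symbols" "HOL-Library.FuncSet"
begin

text \<open>
  Index conventions: \<open>a\<close> and the solutions \<open>F\<close> of the Jacobi equation live on the
  indices \<open>n \<ge> -1\<close> and are therefore functions on \<open>int\<close>; \<open>b\<close> and all derived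
  quantities live on \<open>n \<ge> 0\<close> and are functions on \<open>nat\<close>. Values of \<open>a\<close> below \<open>-1\<close>
  are never used.
\<close>

definition beta :: "(int \<Rightarrow> real) \<Rightarrow> (nat \<Rightarrow> real) \<Rightarrow> nat \<Rightarrow> real" where
  "beta a b n = - b n / (2 * sqrt (a (int n - 1) * a (int n)))"

definition alpha :: "(int \<Rightarrow> real) \<Rightarrow> nat \<Rightarrow> real" where
  "alpha a n = 1 / (2 * sqrt (a (int n - 1) * a (int n)))"

definition kratio :: "(int \<Rightarrow> real) \<Rightarrow> nat \<Rightarrow> real" where
  "kratio a n = a (int n) / sqrt (a (int n - 1) * a (int n + 1))"

definition phase :: "(int \<Rightarrow> real) \<Rightarrow> (nat \<Rightarrow> real) \<Rightarrow> nat \<Rightarrow> real" where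
  "phase a b n = (\<Sum>m | m < n \<and> \<bar>beta a b m\<bar> \<le> 1. arccos (beta a b m))"

text \<open>The sum over \<open>m \<ge> n + 1\<close> is reindexed by \<open>m = n + 1 + j\<close>.\<close>

definition remainder :: "(int \<Rightarrow> real) \<Rightarrow> (nat \<Rightarrow> real) \<Rightarrow> complex \<Rightarrow> nat \<Rightarrow> real" where
  "remainder a b z n =
     (\<Sum>j. \<bar>beta a b (n + j) - beta a b (n + 1 + j)\<bar> + \<bar>kratio a (n + 1 + j) - 1\<bar>
           + alpha a (n + 1 + j) * norm z)"

text \<open>
  Membership in \<open>extensional {-1..}\<close> fixes the irrelevant values at indices below \<open>-1\<close>,
  so that uniqueness of sequences on \<open>n \<ge> -1\<close> is uniqueness of functions on \<open>int\<close>.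
\<close>

definition jacobi_solution ::
  "(int \<Rightarrow> real) \<Rightarrow> (nat \<Rightarrow> real) \<Rightarrow> complex \<Rightarrow> (int \<Rightarrow> complex) \<Rightarrow> bool" where
  "jacobi_solution a b z F \<longleftrightarrow> F \<in> extensional {-1..} \<and>
     (\<forall>n::nat. of_real (a (int n - 1)) * F (int n - 1) + of_real (b n) * F (int n)
               + of_real (a (int n)) * F (int n + 1) = z * F (int n))"

definition orth_poly ::
  "(int \<Rightarrow> real) \<Rightarrow> (nat \<Rightarrow> real) \<Rightarrow> complex \<Rightarrow> int \<Rightarrow> complex" where
  "orth_poly a b z = (THE P. jacobi_solution a b z P \<and> P (-1) = 0 \<and> P 0 = 1)"

definition jost ::
  "(int \<Rightarrow> real) \<Rightarrow> (nat \<Rightarrow> real) \<Rightarrow> complex \<Rightarrow> int \<Rightarrow> complex" where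
  "jost a b z = (THE f. jacobi_solution a b z f \<and>
     (\<lambda>n. f (int n)) \<sim>[sequentially]
     (\<lambda>n. of_real (1 / sqrt (a (int n))) * exp (- \<i> * of_real (phase a b n))))"

definition conj_jost ::
  "(int \<Rightarrow> real) \<Rightarrow> (nat \<Rightarrow> real) \<Rightarrow> complex \<Rightarrow> int \<Rightarrow> complex" where
  "conj_jost a b z n = cnj (jost a b (cnj z) n)"

text \<open>The pair of coefficients of \<open>f\<close> and of its conjugate, in this order.\<close>

definition jost_coeffs ::
  "(int \<Rightarrow> real) \<Rightarrow> (nat \<Rightarrow> real) \<Rightarrow> complex \<Rightarrow> complex \<times> complex" where
  "jost_coeffs a b z = (THE k. \<forall>n\<ge>-1.
     orth_poly a b z n = fst k * jost a b z n + snd k * conj_jost a b z n)"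

definition k_plus :: "(int \<Rightarrow> real) \<Rightarrow> (nat \<Rightarrow> real) \<Rightarrow> complex \<Rightarrow> complex" where
  "k_plus a b z = fst (jost_coeffs a b z)"

definition kappa :: "(int \<Rightarrow> real) \<Rightarrow> (nat \<Rightarrow> real) \<Rightarrow> complex \<Rightarrow> real" where
  "kappa a b z = norm (k_plus a b z)"

text \<open>
  \<open>\<eta>\<close> picks, for every real \<open>x\<close>, a representative of the class in \<open>\<real>/2\<pi>\<int>\<close> determined by
  \<open>k_plus(x) = \<kappa>(x) exp (\<i> \<eta>(x))\<close>.
\<close>

definition is_jost_phase ::
  "(int \<Rightarrow> real) \<Rightarrow> (nat \<Rightarrow> real) \<Rightarrow> (real \<Rightarrow> real) \<Rightarrow> bool" where
  "is_jost_phase a b \<eta> \<longleftrightarrow> (\<forall>x::real.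
     k_plus a b (of_real x) = of_real (kappa a b (of_real x)) * exp (\<i> * of_real (\<eta> x)))"

end

theory Submission imports Defs begin

text \<open>
  With \<open>u\<^sub>n = sqrt a\<^sub>n * F\<^sub>n\<close> the Jacobi equation becomes
  \<open>k\<^sub>n u\<^sub>n\<^sub>+\<^sub>1 + u\<^sub>n\<^sub>-\<^sub>1 = 2 (\<beta>\<^sub>n + z \<alpha>\<^sub>n) u\<^sub>n\<close>, a perturbation of a recurrence whose
  characteristic roots are \<open>w\<^sub>n = exp (\<i> arccos \<beta>\<^sub>n)\<close> and its conjugate. Factoring out one root
  at a time, the quantities \<open>A\<^sub>n = exp (\<i> \<phi>\<^sub>n) (u\<^sub>n\<^sub>+\<^sub>1 - w\<^sub>n u\<^sub>n)\<close> and
  \<open>B\<^sub>n = exp (- \<i> \<phi>\<^sub>n) (u\<^sub>n\<^sub>+\<^sub>1 - cnj w\<^sub>n u\<^sub>n)\<close> have increments bounded by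
  \<open>C \<rho>\<^sub>n (\<bar>A\<^sub>n\<bar> + \<bar>B\<^sub>n\<bar>)\<close>, where the tails of \<open>\<Sum>\<rho>\<^sub>n\<close> are exactly the remainder. So every solution
  has limits of \<open>A\<close> and \<open>B\<close>, attained at the rate of the remainder, and these determine it.
  The Jost solution is the one with limits \<open>(- 2 \<i> \<sigma>, 0)\<close>, \<open>\<sigma> = sqrt (1 - \<beta>lim\<^sup>2)\<close>, its conjugate
  has limits \<open>(0, 2 \<i> \<sigma>)\<close>; comparing with the limits for \<open>P\<close> gives \<open>k_plus = lim A / (- 2 \<i> \<sigma>)\<close>,
  and \<open>B = cnj A\<close> because \<open>P\<close> is real. No estimate on the Jost solution itself is needed.
\<close>

section \<open>Summable perturbations of constant sequences\<close>

text \<open>A discrete Gronwall estimate bounds both sequences by \<open>M\<close>; the increments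
  of \<open>X\<close> are then dominated by a summable sequence, and summing them from
  \<open>n\<close> onwards gives the rate. The explicit \<open>M\<close> is kept because it involves
  only the starting values and the total of \<rho>, which later permits bounds uniform in the
  spectral parameter.\<close>

lemma limit_of_perturbed_constants:
  fixes X Y :: "nat \<Rightarrow> 'a::banach" and \<rho> :: "nat \<Rightarrow> real"
  assumes sm: "summable \<rho>" and \<rho>: "\<And>n. \<rho> n \<ge> 0" and C: "C \<ge> 0"
    and X: "\<And>n. norm (X (Suc n) - X n) \<le> C * \<rho> n * (norm (X n) + norm (Y n))"
    and Y: "\<And>n. norm (Y (Suc n) - Y n) \<le> C * \<rho> n * (norm (X n) + norm (Y n))"
  defines "M \<equiv> (norm (X 0) + norm (Y 0)) * exp (2 * C * suminf \<rho>)"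
  shows "\<exists>L. X \<longlonglongrightarrow> L \<and> (\<forall>n. norm (X n - L) \<le> C * M * (\<Sum>j. \<rho> (n + j))) \<and> norm L \<le> M"
proof -
  \<comment> \<open>One step multiplies the sum of the two norms by at most
    \<open>1 + 2 * C * \<rho> n\<close>, hence by at most an exponential; the factors collect into
    the exponential of the partial sum.\<close>
  have T: "norm (X n) + norm (Y n) \<le> (norm (X 0) + norm (Y 0)) * exp (2 * C * sum \<rho> {..<n})" for n
  proof (induction n)
    case (Suc n)
    have "norm (X (Suc n)) \<le> norm (X n) + C * \<rho> n * (norm (X n) + norm (Y n))"
      using X[of n] norm_triangle_sub[of "X (Suc n)" "X n"] by linarith
    moreover have "norm (Y (Suc n)) \<le> norm (Y n) + C * \<rho> n * (norm (X n) + norm (Y n))"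
      using Y[of n] norm_triangle_sub[of "Y (Suc n)" "Y n"] by linarith
    ultimately have "norm (X (Suc n)) + norm (Y (Suc n))
        \<le> (norm (X n) + norm (Y n)) * (1 + 2 * C * \<rho> n)"
      by (simp add: algebra_simps)
    also have "\<dots> \<le> (norm (X n) + norm (Y n)) * exp (2 * C * \<rho> n)"
      by (intro mult_left_mono exp_ge_add_one_self) auto
    also have "\<dots> \<le> (norm (X 0) + norm (Y 0)) * exp (2 * C * sum \<rho> {..<n}) * exp (2 * C * \<rho> n)"
      by (intro mult_right_mono Suc) auto
    finally show ?case
      by (simp add: mult.assoc distrib_left flip: exp_add)
  qed auto
  have M: "norm (X n) + norm (Y n) \<le> M" for n
  proof -
    have "sum \<rho> {..<n} \<le> suminf \<rho>"
      using sm \<rho> by (intro sum_le_suminf) auto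
    then have "exp (2 * C * sum \<rho> {..<n}) \<le> exp (2 * C * suminf \<rho>)"
      using C by (simp add: mult_left_mono)
    then show ?thesis
      unfolding M_def by (intro order.trans[OF T] mult_left_mono) auto
  qed
  have inc: "norm (X (Suc n) - X n) \<le> C * M * \<rho> n" for n
  proof -
    have "C * \<rho> n * (norm (X n) + norm (Y n)) \<le> C * \<rho> n * M"
      using C \<rho> by (intro mult_left_mono M) auto
    then show ?thesis
      using X[of n] by (simp add: mult_ac)
  qed
  have smX: "summable (\<lambda>n. norm (X (Suc n) - X n))"
    by (rule summable_comparison_test_ev[OF _ summable_mult[OF sm, of "C * M"]]) (simp add: inc)
  define L where "L = X 0 + (\<Sum>n. X (Suc n) - X n)"
  have "(\<lambda>n. \<Sum>k<n. X (Suc k) - X k) \<longlonglongrightarrow> L - X 0"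
    unfolding L_def using summable_LIMSEQ[OF summable_norm_cancel[OF smX]] by simp
  then have "(\<lambda>n. X n - X 0) \<longlonglongrightarrow> L - X 0"
    by (simp add: sum_lessThan_telescope)
  from tendsto_add[OF this tendsto_const[of "X 0"]] have lim: "X \<longlonglongrightarrow> L"
    by simp
  have "norm (X n - L) \<le> C * M * (\<Sum>j. \<rho> (n + j))" for n
  proof -
    have sm': "summable (\<lambda>j. \<rho> (n + j))"
      using summable_ignore_initial_segment[OF sm, of n] by (simp add: add.commute)
    have "0 \<le> M"
      using order.trans[OF add_nonneg_nonneg M[of 0]] by simp
    \<comment> \<open>The finite telescoping bound has a majorant independent of \<open>i\<close>;
      letting \<open>i\<close> grow then replaces \<open>X (n + i)\<close> by the limit.\<close>
    have part: "norm (X n - X (n + i)) \<le> C * M * (\<Sum>j<i. \<rho> (n + j))" for i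
    proof (induction i)
      case (Suc i)
      then show ?case
        using norm_triangle_ineq4[of "X n - X (n + i)" "X (Suc (n + i)) - X (n + i)"] inc[of "n + i"]
        by (simp add: distrib_left)
    qed simp
    have "norm (X n - X (n + i)) \<le> C * M * (\<Sum>j. \<rho> (n + j))" for i
      using C \<rho> sm' \<open>0 \<le> M\<close>
      by (intro order.trans[OF part] mult_left_mono sum_le_suminf mult_nonneg_nonneg) auto
    moreover have "(\<lambda>i. norm (X n - X (n + i))) \<longlonglongrightarrow> norm (X n - L)"
      using LIMSEQ_ignore_initial_segment[OF lim, of n]
      by (intro tendsto_intros) (simp add: add.commute)
    ultimately show ?thesis
      by (intro tendsto_upperbound) auto
  qed
  moreover have "norm (X n) \<le> M" for n
    using M[of n] norm_ge_zero[of "Y n"] by linarith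
  then have "norm L \<le> M"
    by (intro tendsto_upperbound[OF tendsto_norm[OF lim]]) auto
  ultimately show ?thesis
    using lim by blast
qed

section \<open>The Jacobi equation as a linear equation\<close>

text \<open>Separated from extensionality, which linear combinations and conjugates need not
  preserve at indices below -1.\<close>

definition jacobi_recurrence ::
  "(int \<Rightarrow> real) \<Rightarrow> (nat \<Rightarrow> real) \<Rightarrow> complex \<Rightarrow> (int \<Rightarrow> complex) \<Rightarrow> bool" where
  "jacobi_recurrence a b z F \<longleftrightarrow>
     (\<forall>n::nat. of_real (a (int n - 1)) * F (int n - 1) + of_real (b n) * F (int n)
               + of_real (a (int n)) * F (int n + 1) = z * F (int n))"

lemma jacobi_solution_iff:
  "jacobi_solution a b z F \<longleftrightarrow> F \<in> extensional {-1..} \<and> jacobi_recurrence a b z F"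
  by (simp add: jacobi_solution_def jacobi_recurrence_def)

lemma jacobi_recurrence_lincomb:
  assumes "jacobi_recurrence a b z F" "jacobi_recurrence a b z G"
  shows "jacobi_recurrence a b z (\<lambda>n. c * F n + d * G n)"
proof -
  have "of_real (a (int n - 1)) * (c * F (int n - 1) + d * G (int n - 1))
      + of_real (b n) * (c * F (int n) + d * G (int n))
      + of_real (a (int n)) * (c * F (int n + 1) + d * G (int n + 1))
      = z * (c * F (int n) + d * G (int n))" for n
    using arg_cong2[where f="\<lambda>s t. c * s + d * t",
        OF assms[unfolded jacobi_recurrence_def, rule_format, of n]]
    by (simp add: algebra_simps)
  then show ?thesis
    by (simp add: jacobi_recurrence_def)
qed

lemma jacobi_recurrence_cnj:
  assumes "jacobi_recurrence a b (of_real x) F"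
  shows "jacobi_recurrence a b (of_real x) (\<lambda>n. cnj (F n))"
  using assms[unfolded jacobi_recurrence_def, THEN spec, THEN arg_cong[where f=cnj]]
  by (simp add: jacobi_recurrence_def)

section \<open>Solutions from initial data and the orthogonal polynomials\<close>

locale jacobi_coefficients =
  fixes a :: "int \<Rightarrow> real" and b :: "nat \<Rightarrow> real" and \<beta>lim :: real
  assumes a_minus_1: "a (-1) = 1 / 2"
    and a_pos: "\<And>n. n \<ge> 0 \<Longrightarrow> a n > 0"
    and summable_inverse_a: "summable (\<lambda>n::nat. 1 / a (int n))"
    and beta_tendsto: "beta a b \<longlonglongrightarrow> \<beta>lim"
    and beta_lim_less: "\<bar>\<beta>lim\<bar> < 1"
    and summable_kratio: "summable (\<lambda>n. \<bar>kratio a n - 1\<bar>)"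
    and summable_beta_diff: "summable (\<lambda>n. \<bar>beta a b (n + 1) - beta a b n\<bar>)"
begin

abbreviation \<beta> where "\<beta> \<equiv> beta a b"
abbreviation \<alpha> where "\<alpha> \<equiv> alpha a"
abbreviation k where "k \<equiv> kratio a"
abbreviation \<phi> where "\<phi> \<equiv> phase a b"

lemma a_pos': "n \<ge> -1 \<Longrightarrow> a n > 0"
  using a_pos[of n] a_minus_1 by (cases "n = -1") auto

fun forward :: "complex \<Rightarrow> complex \<Rightarrow> complex \<Rightarrow> nat \<Rightarrow> complex" where
  "forward z p q 0 = p"
| "forward z p q (Suc 0) = q"
| "forward z p q (Suc (Suc n)) =
     ((z - of_real (b n)) * forward z p q (Suc n)
      - of_real (a (int n - 1)) * forward z p q n) / of_real (a (int n))"

text \<open>The list index \<open>n\<close> of \<open>forward\<close> corresponds to the index \<open>n - 1\<close> of the solution.\<close>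

definition solution :: "complex \<Rightarrow> complex \<Rightarrow> complex \<Rightarrow> int \<Rightarrow> complex" where
  "solution z p q = restrict (\<lambda>n. forward z p q (nat (n + 1))) {-1..}"

lemma solution_initial [simp]: "solution z p q (-1) = p" "solution z p q 0 = q"
  by (simp_all add: solution_def)

lemma jacobi_solution_solution: "jacobi_solution a b z (solution z p q)"
proof -
  have "of_real (a (int n - 1)) * forward z p q n + of_real (b n) * forward z p q (Suc n)
      + of_real (a (int n)) * forward z p q (Suc (Suc n)) = z * forward z p q (Suc n)" for n
    using a_pos[of "int n"] by (simp add: field_simps)
  moreover have "nat (int n + 1) = Suc n" "nat (int n + 1 + 1) = Suc (Suc n)" for n
    by auto
  ultimately have "jacobi_recurrence a b z (solution z p q)"
    by (simp add: jacobi_recurrence_def solution_def)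
  then show ?thesis
    by (simp add: jacobi_solution_iff solution_def)
qed

lemma jacobi_recurrence_solution: "jacobi_recurrence a b z (solution z p q)"
  using jacobi_solution_solution jacobi_solution_iff by blast

lemma recurrence_eq_0_forward:
  assumes F: "jacobi_recurrence a b z F" and "F (-1) = 0" "F 0 = 0" and n: "n \<ge> -1"
  shows "F n = 0"
proof -
  have "F (int m - 1) = 0 \<and> F (int m) = 0" for m
  proof (induction m)
    case (Suc m)
    have "of_real (a (int m)) * F (int m + 1) = 0"
      using F[unfolded jacobi_recurrence_def, rule_format, of m] Suc by simp
    then show ?case
      using Suc a_pos[of "int m"] by (simp add: add.commute)
  qed (use assms in auto)
  from this[of "nat (n + 1)"] n show ?thesis by simp
qed

text \<open>Vanishing of a solution will be detected only at large indices. Since every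
  \<open>a (int m - 1)\<close> is nonzero, including \<open>a (-1)\<close>, the recurrence can be
  run downwards to the initial values.\<close>

lemma recurrence_eq_0_backward:
  assumes F: "jacobi_recurrence a b z F" and N: "F (int N) = 0" "F (int N + 1) = 0" and "n \<ge> -1"
  shows "F n = 0"
proof -
  have "F (int m - 1) = 0 \<and> F (int m) = 0" if "F (int m) = 0" "F (int m + 1) = 0" for m
    using F[unfolded jacobi_recurrence_def, rule_format, of m] that a_pos'[of "int m - 1"] by simp
  then have step: "F (int m - 1) = 0 \<and> F (int m) = 0" if "F (int m) = 0" "F (int m + 1) = 0" for m
    using that by blast
  have "F (-1) = 0 \<and> F 0 = 0"
    using N
  proof (induction N)
    case 0
    then show ?case using step[of 0] by simp
  next
    case (Suc N)
    then show ?case using step[of "Suc N"] by (simp add: add.commute)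
  qed
  then show ?thesis
    using recurrence_eq_0_forward[OF F] \<open>n \<ge> -1\<close> by blast
qed

lemma recurrence_unique:
  assumes "jacobi_recurrence a b z F" "jacobi_recurrence a b z G" "F (-1) = G (-1)" "F 0 = G 0" "n \<ge> -1"
  shows "F n = G n"
  using recurrence_eq_0_forward[OF jacobi_recurrence_lincomb[OF assms(1,2), of 1 "-1"]] assms(3-)
  by simp

lemma extensional_eqI:
  assumes "F \<in> extensional {-1..}" "G \<in> extensional {-1..}" "\<And>n. n \<ge> -1 \<Longrightarrow> F n = G n"
  shows "F = (G :: int \<Rightarrow> complex)"
  using assms by (auto intro: extensionalityI)

lemma orth_poly_eq: "orth_poly a b z = solution z 0 1"
  unfolding orth_poly_def
proof (rule the_equality)
  fix P assume "jacobi_solution a b z P \<and> P (-1) = 0 \<and> P 0 = 1"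
  then have P: "P \<in> extensional {-1..}" "jacobi_recurrence a b z P" "P (-1) = 0" "P 0 = 1"
    by (simp_all add: jacobi_solution_iff)
  show "P = solution z 0 1"
  proof (rule extensional_eqI[OF P(1)])
    show "solution z 0 1 \<in> extensional {-1..}"
      using jacobi_solution_solution jacobi_solution_iff by blast
    show "P n = solution z 0 1 n" if "n \<ge> -1" for n
      using recurrence_unique[OF P(2) jacobi_recurrence_solution] P(3,4) that by simp
  qed
qed (simp add: jacobi_solution_solution)

lemma orth_poly_real:
  assumes "n \<ge> -1"
  shows "cnj (orth_poly a b (of_real x) n) = orth_poly a b (of_real x) n"
  unfolding orth_poly_eq
  by (rule recurrence_unique[OF jacobi_recurrence_cnj jacobi_recurrence_solution])
     (use assms jacobi_recurrence_solution in auto)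

text \<open>At a fixed index the polynomial is bounded on a disk, by induction on two consecutive
  terms. Together with \<open>remainder_mono\<close> this makes the final constants uniform on
  compact sets.\<close>

lemma orth_poly_bounded: "\<exists>M. \<forall>z. norm z \<le> R \<longrightarrow> norm (orth_poly a b z (int n)) \<le> M"
proof -
  have "\<exists>M. \<forall>z. norm z \<le> R \<longrightarrow> norm (forward z 0 1 n) \<le> M \<and> norm (forward z 0 1 (Suc n)) \<le> M" for n
  proof (induction n)
    case (Suc n)
    then obtain M where M: "\<And>z. norm z \<le> R \<Longrightarrow> norm (forward z 0 1 n) \<le> M"
      "\<And>z. norm z \<le> R \<Longrightarrow> norm (forward z 0 1 (Suc n)) \<le> M" by blast
    define M' where "M' = ((R + \<bar>b n\<bar>) * M + a (int n - 1) * M) / a (int n)"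
    have "norm (forward z 0 1 (Suc (Suc n))) \<le> M'" if z: "norm z \<le> R" for z
    proof -
      have "norm (z - of_real (b n)) \<le> R + \<bar>b n\<bar>"
        using norm_triangle_ineq4[of z "of_real (b n)"] z by simp
      then have "norm ((z - of_real (b n)) * forward z 0 1 (Suc n)) \<le> (R + \<bar>b n\<bar>) * M"
        unfolding norm_mult using M(2)[OF z] order.trans[OF norm_ge_zero, of z R] z
        by (intro mult_mono) auto
      moreover have "norm (of_real (a (int n - 1)) * forward z 0 1 n) \<le> a (int n - 1) * M"
        unfolding norm_mult using M(1)[OF z] a_pos'[of "int n - 1"] by (simp add: mult_left_mono)
      ultimately have "norm ((z - of_real (b n)) * forward z 0 1 (Suc n)
          - of_real (a (int n - 1)) * forward z 0 1 n) \<le> (R + \<bar>b n\<bar>) * M + a (int n - 1) * M"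
        by (rule order.trans[OF norm_triangle_ineq4 add_mono])
      then show ?thesis
        using a_pos[of "int n"] by (simp add: M'_def norm_divide divide_right_mono)
    qed
    with M(2) show ?case
      by (intro exI[of _ "max M M'"]) (auto simp del: forward.simps intro: max.coboundedI1 max.coboundedI2)
  qed (auto intro!: exI[of _ 1])
  from this[of "Suc n"] show ?thesis
    by (auto simp: orth_poly_eq solution_def nat_add_distrib simp del: forward.simps)
qed

section \<open>Factored variables and the bound on their increments\<close>

definition S :: "nat \<Rightarrow> real" where "S n = sqrt (1 - (\<beta> n)\<^sup>2)"
definition \<sigma> :: real where "\<sigma> = sqrt (1 - \<beta>lim\<^sup>2)"
text \<open>Written algebraically rather than through \<open>arccos\<close>, so that limits and
  differences reduce to those of \<beta>.\<close>

definition w :: "nat \<Rightarrow> complex" where "w n = Complex (\<beta> n) (S n)"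
definition E :: "nat \<Rightarrow> complex" where "E n = cis (\<phi> n)"
text \<open>The summand with m = n + 1 of the remainder, so that the tail from \<open>n\<close> on
  is the remainder at \<open>n\<close> without a shift.\<close>

definition \<rho> :: "complex \<Rightarrow> nat \<Rightarrow> real" where
  "\<rho> z n = \<bar>\<beta> n - \<beta> (Suc n)\<bar> + \<bar>k (Suc n) - 1\<bar> + \<alpha> (Suc n) * norm z"
definition u :: "(int \<Rightarrow> complex) \<Rightarrow> nat \<Rightarrow> complex" where
  "u F n = of_real (sqrt (a (int n))) * F (int n)"
definition A :: "(int \<Rightarrow> complex) \<Rightarrow> nat \<Rightarrow> complex" where
  "A F n = E n * (u F (Suc n) - w n * u F n)"
definition B :: "(int \<Rightarrow> complex) \<Rightarrow> nat \<Rightarrow> complex" where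
  "B F n = cnj (E n) * (u F (Suc n) - cnj (w n) * u F n)"
definition T :: "(int \<Rightarrow> complex) \<Rightarrow> nat \<Rightarrow> real" where
  "T F n = norm (A F n) + norm (B F n)"
text \<open>The indices that contribute to the phase and at which division by \<open>S n\<close> and
  \<open>k n\<close> costs only a fixed constant. All large indices are good, independently of
  z.\<close>

definition good :: "nat \<Rightarrow> bool" where
  "good n \<longleftrightarrow> \<bar>\<beta> n\<bar> \<le> 1 \<and> \<sigma> / 2 \<le> S n \<and> 1 / 2 \<le> k n"

lemma sigma_pos: "0 < \<sigma>" and sigma_le_1: "\<sigma> \<le> 1"
  using beta_lim_less by (auto simp: \<sigma>_def abs_square_less_1)

lemma S_tendsto: "S \<longlonglongrightarrow> \<sigma>"
  unfolding S_def \<sigma>_def by (intro tendsto_intros beta_tendsto)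

lemma eventually_good: "eventually good sequentially"
proof -
  have "\<forall>\<^sub>F n in sequentially. \<bar>\<beta> n\<bar> < 1"
    using order_tendstoD(2)[OF tendsto_rabs[OF beta_tendsto] beta_lim_less] .
  moreover have "\<forall>\<^sub>F n in sequentially. \<sigma> / 2 < S n"
    using order_tendstoD(1)[OF S_tendsto, of "\<sigma> / 2"] sigma_pos by simp
  moreover have "\<forall>\<^sub>F n in sequentially. \<bar>k n - 1\<bar> < 1 / 2"
    using order_tendstoD(2)[OF summable_LIMSEQ_zero[OF summable_kratio], of "1 / 2"] by simp
  ultimately show ?thesis
    by eventually_elim (auto simp: good_def abs_if split: if_splits)
qed

lemma norm_E [simp]: "norm (E n) = 1"
  by (simp add: E_def)

lemma E_cnj [simp]: "E n * cnj (E n) = 1" "cnj (E n) * E n = 1"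
  by (simp_all add: E_def cis_cnj cis_mult)

text \<open>At a good index the phase gains exactly \<open>arccos (\<beta> n)\<close>, and
  \<open>w n\<close> is the corresponding point of the unit circle.\<close>

lemma E_Suc: "good n \<Longrightarrow> E (Suc n) = E n * w n"
proof -
  assume "good n"
  then have n: "\<bar>\<beta> n\<bar> \<le> 1" by (simp add: good_def)
  then have "{m. m < Suc n \<and> \<bar>\<beta> m\<bar> \<le> 1} = insert n {m. m < n \<and> \<bar>\<beta> m\<bar> \<le> 1}"
    by auto
  then have "\<phi> (Suc n) = \<phi> n + arccos (\<beta> n)"
    by (simp add: phase_def)
  moreover have "cis (arccos (\<beta> n)) = w n"
    using n by (simp add: w_def S_def complex_eq_iff cos_arccos_abs sin_arccos_abs)
  ultimately show ?thesis
    by (simp add: E_def flip: cis_mult)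
qed

lemma w_cnj: "good n \<Longrightarrow> w n * cnj (w n) = 1" and norm_w: "good n \<Longrightarrow> norm (w n) = 1"
  and w_add_cnj: "w n + cnj (w n) = 2 * of_real (\<beta> n)"
  and w_diff_cnj: "w n - cnj (w n) = 2 * \<i> * of_real (S n)"
proof -
  show "w n * cnj (w n) = 1" if "good n"
    using that by (simp add: w_def S_def good_def complex_eq_iff abs_square_le_1 flip: power2_eq_square)
  show "norm (w n) = 1" if "good n"
    using that by (simp add: w_def S_def good_def cmod_def abs_square_le_1)
qed (simp_all add: w_def complex_eq_iff)

text \<open>This is the Jacobi equation at index n + 1 divided by \<open>sqrt (a (int n))\<close>.
  Naming three consecutive square roots turns the verification into field arithmetic.\<close>

lemma u_recurrence:
  assumes "jacobi_recurrence a b z F"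
  shows "of_real (k (Suc n)) * u F (Suc (Suc n)) + u F n
    = (2 * of_real (\<beta> (Suc n)) + 2 * z * of_real (\<alpha> (Suc n))) * u F (Suc n)"
proof -
  define p q r where "p = sqrt (a (int n))" and "q = sqrt (a (int n + 1))" and "r = sqrt (a (int n + 2))"
  have pos: "p > 0" "q > 0" "r > 0"
    using a_pos by (auto simp: p_def q_def r_def)
  have a: "a (int n) = p * p" "a (int n + 1) = q * q" "a (int n + 2) = r * r"
    using a_pos[of "int n"] a_pos[of "int n + 1"] a_pos[of "int n + 2"]
    by (simp_all add: p_def q_def r_def)
  have idx: "int (Suc n) = int n + 1" "int (Suc (Suc n)) = int n + 2"
    "int n + 1 + 1 = int n + 2" "int n + 1 - 1 = int n"
    by auto
  have rec: "of_real (p * p) * F (int n) + of_real (b (Suc n)) * F (int n + 1)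
      + of_real (q * q) * F (int n + 2) = z * F (int n + 1)"
    using assms[unfolded jacobi_recurrence_def, rule_format, of "Suc n"] unfolding idx a .
  have k: "k (Suc n) = q * q / (p * r)"
    unfolding kratio_def idx a using pos by (simp add: real_sqrt_mult)
  have \<beta>: "\<beta> (Suc n) = - b (Suc n) / (2 * (p * q))"
    unfolding beta_def idx a using pos by (simp add: real_sqrt_mult)
  have \<alpha>: "\<alpha> (Suc n) = 1 / (2 * (p * q))"
    unfolding alpha_def idx a using pos by (simp add: real_sqrt_mult)
  have uu: "u F n = of_real p * F (int n)" "u F (Suc n) = of_real q * F (int n + 1)"
    "u F (Suc (Suc n)) = of_real r * F (int n + 2)"
    by (simp_all only: u_def p_def q_def r_def idx)
  have "of_real (k (Suc n)) * u F (Suc (Suc n)) + u F n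
     = (of_real (q * q) * F (int n + 2) + of_real (p * p) * F (int n)) / of_real p"
    using pos by (simp add: k uu field_simps)
  also have "of_real (q * q) * F (int n + 2) + of_real (p * p) * F (int n)
     = (z - of_real (b (Suc n))) * F (int n + 1)"
    using rec by (simp add: algebra_simps)
  also have "\<dots> / of_real p
     = (2 * of_real (\<beta> (Suc n)) + 2 * z * of_real (\<alpha> (Suc n))) * u F (Suc n)"
    using pos by (simp add: \<beta> \<alpha> uu field_simps)
  finally show ?thesis .
qed

text \<open>The squares of \<open>S\<close> differ as those of \<beta> do, up to sign; factor both
  differences and divide by \<open>S m + S n\<close>, which is at least \<sigma>.\<close>

lemma S_diff:
  assumes "good m" "good n"
  shows "\<bar>S m - S n\<bar> \<le> 2 / \<sigma> * \<bar>\<beta> m - \<beta> n\<bar>"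
proof -
  have *: "\<bar>\<beta> m\<bar> \<le> 1" "\<bar>\<beta> n\<bar> \<le> 1" and S: "\<sigma> \<le> S m + S n"
    using assms by (auto simp: good_def)
  then have "(S m)\<^sup>2 = 1 - (\<beta> m)\<^sup>2" "(S n)\<^sup>2 = 1 - (\<beta> n)\<^sup>2"
    by (simp_all add: S_def abs_square_le_1)
  then have "(S m - S n) * (S m + S n) = (\<beta> n - \<beta> m) * (\<beta> n + \<beta> m)"
    by (simp add: power2_eq_square algebra_simps)
  then have "\<bar>S m - S n\<bar> * \<bar>S m + S n\<bar> = \<bar>\<beta> n - \<beta> m\<bar> * \<bar>\<beta> n + \<beta> m\<bar>"
    by (simp flip: abs_mult)
  also have "\<dots> \<le> \<bar>\<beta> n - \<beta> m\<bar> * 2"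
    using * by (intro mult_left_mono) auto
  finally have "\<bar>S m - S n\<bar> * \<bar>S m + S n\<bar> \<le> 2 * \<bar>\<beta> m - \<beta> n\<bar>"
    by (simp add: abs_minus_commute)
  moreover have "\<bar>S m - S n\<bar> * \<sigma> \<le> \<bar>S m - S n\<bar> * \<bar>S m + S n\<bar>"
    using S by (intro mult_left_mono) auto
  ultimately show ?thesis
    using sigma_pos by (simp add: field_simps)
qed

lemma w_diff:
  assumes "good m" "good n"
  shows "norm (w m - w n) \<le> 3 / \<sigma> * \<bar>\<beta> m - \<beta> n\<bar>"
proof -
  have "norm (w m - w n) \<le> \<bar>\<beta> m - \<beta> n\<bar> + \<bar>S m - S n\<bar>"
    using cmod_le[of "w m - w n"] by (simp add: w_def)
  \<comment> \<open>The real part contributes 1 / \<sigma>, because \<sigma> is at most 1, and the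
    imaginary part 2 / \<sigma> by \<open>S_diff\<close>; hence the constant 3.\<close>
  moreover have "\<bar>\<beta> m - \<beta> n\<bar> \<le> 1 / \<sigma> * \<bar>\<beta> m - \<beta> n\<bar>"
    using sigma_pos sigma_le_1 mult_left_le[of \<sigma> "\<bar>\<beta> m - \<beta> n\<bar>"] by (simp add: field_simps)
  ultimately show ?thesis
    using S_diff[OF assms] by (simp add: field_simps)
qed

text \<open>Up to the unimodular factors, \<open>A\<close> and \<open>B\<close> are two linear forms
  in \<open>u F (Suc n)\<close> and \<open>u F n\<close> with determinant 2 i \<open>S n\<close>.
  This lemma and \<open>u_Suc_eq\<close> invert them.\<close>

lemma u_eq: "2 * \<i> * of_real (S n) * u F n = E n * B F n - cnj (E n) * A F n"
proof -
  have "E n * B F n - cnj (E n) * A F n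
      = (E n * cnj (E n)) * (u F (Suc n) - cnj (w n) * u F n)
        - (cnj (E n) * E n) * (u F (Suc n) - w n * u F n)"
    by (simp only: A_def B_def mult.assoc)
  also have "\<dots> = (w n - cnj (w n)) * u F n"
    by (simp add: algebra_simps)
  finally show ?thesis
    by (simp add: w_diff_cnj)
qed

lemma u_Suc_eq:
  assumes "good n"
  shows "2 * \<i> * of_real (S n) * u F (Suc n) = w n * E n * B F n - cnj (w n) * cnj (E n) * A F n"
proof -
  have "w n * E n * B F n - cnj (w n) * cnj (E n) * A F n
      = (E n * cnj (E n)) * (w n * u F (Suc n) - (w n * cnj (w n)) * u F n)
        - (cnj (E n) * E n) * (cnj (w n) * u F (Suc n) - (w n * cnj (w n)) * u F n)"
    by (simp only: A_def B_def algebra_simps)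
  also have "\<dots> = (w n - cnj (w n)) * u F (Suc n)"
    by (simp add: w_cnj[OF assms] algebra_simps)
  finally show ?thesis
    by (simp add: w_diff_cnj)
qed

lemma u_bounds:
  assumes "good n"
  shows "norm (u F n) \<le> T F n / \<sigma>" "norm (u F (Suc n)) \<le> T F n / \<sigma>"
proof -
  have S: "\<sigma> \<le> 2 * S n" "0 \<le> S n"
    using assms sigma_pos by (auto simp: good_def)
  have "2 * S n * norm (u F n) = norm (E n * B F n - cnj (E n) * A F n)"
    using S by (simp flip: u_eq add: norm_mult)
  also have "\<dots> \<le> T F n"
    using norm_triangle_ineq4[of "E n * B F n" "cnj (E n) * A F n"] by (simp add: T_def norm_mult)
  finally have "\<sigma> * norm (u F n) \<le> T F n"
    using mult_right_mono[OF S(1) norm_ge_zero[of "u F n"]] by linarith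
  then show "norm (u F n) \<le> T F n / \<sigma>"
    using sigma_pos by (simp add: field_simps)
  have "2 * S n * norm (u F (Suc n)) = norm (w n * E n * B F n - cnj (w n) * cnj (E n) * A F n)"
    using S by (simp flip: u_Suc_eq[OF assms] add: norm_mult)
  also have "\<dots> \<le> T F n"
    using norm_triangle_ineq4[of "w n * E n * B F n" "cnj (w n) * cnj (E n) * A F n"]
    by (simp add: T_def norm_mult norm_w[OF assms])
  finally have "\<sigma> * norm (u F (Suc n)) \<le> T F n"
    using mult_right_mono[OF S(1) norm_ge_zero[of "u F (Suc n)"]] by linarith
  then show "norm (u F (Suc n)) \<le> T F n / \<sigma>"
    using sigma_pos by (simp add: field_simps)
qed

lemma alpha_pos: "\<alpha> n > 0"
  using a_pos'[of "int n - 1"] a_pos[of "int n"] by (simp add: alpha_def)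

lemma rho_nonneg: "\<rho> z n \<ge> 0"
  using alpha_pos[of "Suc n"] by (simp add: \<rho>_def)

text \<open>Two effects move \<open>A\<close> and \<open>B\<close>: the root changes from
  \<open>w n\<close> to \<open>w (Suc n)\<close>, at the cost of the \<beta> difference, and
  \<open>u F\<close> misses the unperturbed recurrence by a defect governed by \<open>k\<close> and
  \<alpha>.\<close>

lemma increments:
  assumes F: "jacobi_recurrence a b z F" and good: "good n" "good (Suc n)"
  shows "norm (A F (Suc n) - A F n) \<le> 6 / \<sigma>\<^sup>2 * \<rho> z n * T F n"
    and "norm (B F (Suc n) - B F n) \<le> 6 / \<sigma>\<^sup>2 * \<rho> z n * T F n"
proof -
  define \<kappa> where "\<kappa> = k (Suc n)"
  \<comment> \<open>The defect of \<open>u F\<close> in the recurrence whose characteristic roots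
    are \<open>w (Suc n)\<close> and its conjugate.\<close>
  define s where "s = u F (Suc (Suc n)) + u F n - 2 * of_real (\<beta> (Suc n)) * u F (Suc n)"
  have \<kappa>: "1 / 2 \<le> \<kappa>" and \<beta>1: "\<bar>\<beta> (Suc n)\<bar> \<le> 1"
    using good by (auto simp: good_def \<kappa>_def)
  define t where "t = T F n / \<sigma>"
  have u: "norm (u F n) \<le> t" "norm (u F (Suc n)) \<le> t" and t: "0 \<le> t"
    using u_bounds[OF good(1)] sigma_pos by (auto simp: t_def T_def)
  have "of_real \<kappa> * s = of_real (1 - \<kappa>) * (2 * of_real (\<beta> (Suc n)) * u F (Suc n) - u F n)
      + 2 * z * of_real (\<alpha> (Suc n)) * u F (Suc n)"
    using u_recurrence[OF F, of n] unfolding s_def \<kappa>_def by (simp add: algebra_simps)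
  then have "\<kappa> * norm s \<le> norm (of_real (1 - \<kappa>) * (2 * of_real (\<beta> (Suc n)) * u F (Suc n) - u F n))
      + norm (2 * z * of_real (\<alpha> (Suc n)) * u F (Suc n))"
    using \<kappa> norm_mult[of "of_real \<kappa>" s] by (metis norm_triangle_ineq norm_of_real abs_of_nonneg order.trans zero_le_divide_1_iff zero_le_numeral)
  also have "norm (of_real (1 - \<kappa>) * (2 * of_real (\<beta> (Suc n)) * u F (Suc n) - u F n)) \<le> \<bar>\<kappa> - 1\<bar> * (3 * t)"
  proof -
    have "norm (2 * of_real (\<beta> (Suc n)) * u F (Suc n)) \<le> 2 * t"
      using mult_mono[OF \<beta>1 u(2)] by (simp add: norm_mult)
    then have "norm (2 * of_real (\<beta> (Suc n)) * u F (Suc n) - u F n) \<le> 3 * t"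
      using norm_triangle_ineq4[of "2 * of_real (\<beta> (Suc n)) * u F (Suc n)" "u F n"] u(1) by linarith
    then show ?thesis
      unfolding norm_mult norm_of_real abs_minus_commute[of 1] by (intro mult_left_mono) auto
  qed
  also have "norm (2 * z * of_real (\<alpha> (Suc n)) * u F (Suc n)) \<le> 2 * norm z * \<alpha> (Suc n) * t"
    using u(2) alpha_pos[of "Suc n"] by (simp add: norm_mult mult_left_mono)
  finally have "\<kappa> * norm s \<le> \<bar>\<kappa> - 1\<bar> * (3 * t) + 2 * norm z * \<alpha> (Suc n) * t"
    by simp
  moreover have "1 / 2 * norm s \<le> \<kappa> * norm s"
    using \<kappa> by (intro mult_right_mono) auto
  \<comment> \<open>Removing \<kappa>, which is at least 1 / 2, doubles the constants 3 and
    2.\<close>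
  ultimately have s: "norm s \<le> 6 * \<bar>\<kappa> - 1\<bar> * t + 4 * (\<alpha> (Suc n) * norm z) * t"
    by (simp add: algebra_simps)
  have total: "norm (v * u F (Suc n) + s) \<le> 6 / \<sigma>\<^sup>2 * \<rho> z n * T F n"
    if v: "norm v \<le> 3 / \<sigma> * \<bar>\<beta> n - \<beta> (Suc n)\<bar>" for v
  proof -
    have "norm (v * u F (Suc n)) \<le> 3 / \<sigma> * \<bar>\<beta> n - \<beta> (Suc n)\<bar> * t"
      unfolding norm_mult using v u(2) t sigma_pos by (intro mult_mono) auto
    then have "norm (v * u F (Suc n) + s)
        \<le> 3 / \<sigma> * \<bar>\<beta> n - \<beta> (Suc n)\<bar> * t + (6 * \<bar>\<kappa> - 1\<bar> * t + 4 * (\<alpha> (Suc n) * norm z) * t)"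
      using s by (intro order.trans[OF norm_triangle_ineq add_mono]) auto
    also have "\<dots> = (3 / \<sigma> * \<bar>\<beta> n - \<beta> (Suc n)\<bar> + 6 * \<bar>\<kappa> - 1\<bar> + 4 * (\<alpha> (Suc n) * norm z)) * t"
      by (simp add: algebra_simps)
    \<comment> \<open>Since \<sigma> is at most 1, the constants 3 / \<sigma>, 6 and 4 all lie below
      6 / \<sigma>. The second factor 1 / \<sigma> of the final bound is hidden in
      \<open>t\<close>.\<close>
    also have "\<dots> \<le> (6 / \<sigma> * \<bar>\<beta> n - \<beta> (Suc n)\<bar> + 6 / \<sigma> * \<bar>\<kappa> - 1\<bar> + 6 / \<sigma> * (\<alpha> (Suc n) * norm z)) * t"
    proof (intro mult_right_mono add_mono)
      have "6 \<le> 6 / \<sigma>" using sigma_pos sigma_le_1 by (simp add: field_simps)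
      then show "6 \<le> 6 / \<sigma>" "4 \<le> 6 / \<sigma>" by auto
      show "3 / \<sigma> \<le> 6 / \<sigma>" using sigma_pos by (simp add: field_simps)
    qed (use t alpha_pos[of "Suc n"] in auto)
    also have "\<dots> = 6 / \<sigma>\<^sup>2 * \<rho> z n * T F n"
      using sigma_pos by (simp add: \<rho>_def \<kappa>_def t_def power2_eq_square field_simps)
    finally show ?thesis .
  qed
  have E: "E (Suc n) = E n * w n"
    by (rule E_Suc[OF good(1)])
  have ww: "w n * cnj (w n) = 1" "cnj (w n) * w n = 1"
    using w_cnj[OF good(1)] by (simp_all add: mult.commute)
  have \<beta>2: "2 * of_real (\<beta> (Suc n)) = w (Suc n) + cnj (w (Suc n))"
    by (simp add: w_add_cnj)
  have uSS: "u F (Suc (Suc n)) = (w (Suc n) + cnj (w (Suc n))) * u F (Suc n) - u F n + s"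
    by (simp add: s_def \<beta>2)
  \<comment> \<open>Because \<open>w n\<close> has inverse \<open>cnj (w n)\<close>, the factor
    \<open>E (Suc n)\<close> can be pulled out of \<open>A F n\<close> as well; both values then
    carry the same phase and can be subtracted.\<close>
  have An: "A F n = E (Suc n) * (cnj (w n) * u F (Suc n) - u F n)"
  proof -
    have "E (Suc n) * (cnj (w n) * u F (Suc n) - u F n)
        = E n * ((w n * cnj (w n)) * u F (Suc n) - w n * u F n)"
      by (simp only: E algebra_simps)
    then show ?thesis by (simp add: A_def ww)
  qed
  have ASuc: "A F (Suc n) = E (Suc n) * (cnj (w (Suc n)) * u F (Suc n) - u F n + s)"
    unfolding A_def uSS by (simp add: algebra_simps)
  have "A F (Suc n) - A F n = E (Suc n) * (cnj (w (Suc n) - w n) * u F (Suc n) + s)"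
    unfolding An ASuc by (simp add: algebra_simps)
  then show "norm (A F (Suc n) - A F n) \<le> 6 / \<sigma>\<^sup>2 * \<rho> z n * T F n"
    using total[of "cnj (w (Suc n) - w n)"] w_diff[OF good(2,1)]
    by (simp only: norm_mult norm_E complex_mod_cnj abs_minus_commute[of "\<beta> n"] mult_1)
  have Bn: "B F n = cnj (E (Suc n)) * (w n * u F (Suc n) - u F n)"
  proof -
    have "cnj (E (Suc n)) * (w n * u F (Suc n) - u F n)
        = cnj (E n) * ((cnj (w n) * w n) * u F (Suc n) - cnj (w n) * u F n)"
      by (simp only: E complex_cnj_mult algebra_simps)
    then show ?thesis by (simp add: B_def ww)
  qed
  have BSuc: "B F (Suc n) = cnj (E (Suc n)) * (w (Suc n) * u F (Suc n) - u F n + s)"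
    unfolding B_def uSS by (simp add: algebra_simps)
  have "B F (Suc n) - B F n = cnj (E (Suc n)) * ((w (Suc n) - w n) * u F (Suc n) + s)"
    unfolding Bn BSuc by (simp add: algebra_simps)
  then show "norm (B F (Suc n) - B F n) \<le> 6 / \<sigma>\<^sup>2 * \<rho> z n * T F n"
    using total[of "w (Suc n) - w n"] w_diff[OF good(2,1)]
    by (simp only: norm_mult norm_E complex_mod_cnj abs_minus_commute[of "\<beta> n"] mult_1)
qed

section \<open>Summability and the remainder\<close>

text \<open>The inequality of arithmetic and geometric means for the reciprocals of two consecutive
  coefficients bounds \<alpha> by the summable reciprocals.\<close>

lemma summable_alpha: "summable (\<lambda>n. \<alpha> (Suc n))"
proof (rule summable_comparison_test_ev)
  have "sqrt (x * y) \<le> x + y" if "x > 0" "y > 0" for x y :: real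
    using arith_geo_mean_sqrt[of x y] that by simp
  from this[of "1 / x" "1 / y" for x y] have "1 / sqrt (x * y) \<le> 1 / x + 1 / y"
    if "x > 0" "y > 0" for x y :: real
    using that by (simp add: real_sqrt_divide)
  then have "1 / sqrt (a (int n) * a (1 + int n)) \<le> 1 / a (int n) + 1 / a (int (Suc n))" for n
    using a_pos[of "int n"] a_pos[of "1 + int n"] by simp
  moreover have "\<alpha> (Suc n) \<le> 1 / sqrt (a (int n) * a (1 + int n))" for n
    using a_pos[of "int n"] a_pos[of "1 + int n"] by (simp add: alpha_def divide_simps)
  ultimately have "norm (\<alpha> (Suc n)) \<le> 1 / a (int n) + 1 / a (int (Suc n))" for n
    using alpha_pos[of "Suc n"] by (auto intro: order.trans)
  then show "\<forall>\<^sub>F n in sequentially. norm (\<alpha> (Suc n)) \<le> 1 / a (int n) + 1 / a (int (Suc n))"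
    by simp
  show "summable (\<lambda>n. 1 / a (int n) + 1 / a (int (Suc n)))"
    using summable_add[OF summable_inverse_a] summable_inverse_a
      summable_Suc_iff[of "\<lambda>n. 1 / a (int n)"] by blast
qed

lemma summable_rho: "summable (\<rho> z)"
  unfolding \<rho>_def
  using summable_beta_diff summable_alpha summable_kratio[THEN summable_Suc_iff[THEN iffD2]]
  by (intro summable_add summable_mult2) (simp_all add: abs_minus_commute)

lemma remainder_eq: "remainder a b z n = (\<Sum>j. \<rho> z (n + j))"
  by (simp add: remainder_def \<rho>_def)

lemma summable_rho_shift: "summable (\<lambda>j. \<rho> z (n + j))"
  using summable_rho[THEN summable_ignore_initial_segment, of z n] by (simp add: add.commute)

lemma remainder_nonneg: "remainder a b z n \<ge> 0"
  unfolding remainder_eq by (intro suminf_nonneg summable_rho_shift rho_nonneg)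

lemma remainder_tendsto: "remainder a b z \<longlonglongrightarrow> 0"
  using suminf_exist_split2[OF summable_rho[of z]]
  by (simp add: remainder_eq[abs_def] add.commute)

lemma remainder_mono:
  assumes "norm z \<le> norm z'" shows "remainder a b z n \<le> remainder a b z' n"
  unfolding remainder_eq
  using assms alpha_pos[THEN less_imp_le]
  by (intro suminf_le summable_rho_shift) (simp add: \<rho>_def mult_left_mono)

section \<open>Limits of \<open>A\<close> and \<open>B\<close>, and the solution they
  determine\<close>

text \<open>The Gronwall bound of \<open>limit_of_perturbed_constants\<close> for the sequences
  started at \<open>n\<close>, with C = \<open>6 / \<sigma>\<^sup>2\<close>; hence 12 in the
  exponent.\<close>

definition M :: "complex \<Rightarrow> (int \<Rightarrow> complex) \<Rightarrow> nat \<Rightarrow> real" where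
  "M z F n = T F n * exp (12 / \<sigma>\<^sup>2 * remainder a b z n)"

text \<open>The perturbation lemma is applied to the sequences shifted by \<open>N\<close>, where
  the increment bound is available at every index.\<close>

lemma limits_from:
  assumes F: "jacobi_recurrence a b z F" and good: "\<And>m. m \<ge> N \<Longrightarrow> good m"
  shows "\<exists>L. A F \<longlonglongrightarrow> L \<and> (\<forall>n\<ge>N. norm (A F n - L) \<le> 6 / \<sigma>\<^sup>2 * M z F N * remainder a b z n) \<and> norm L \<le> M z F N"
    and "\<exists>L. B F \<longlonglongrightarrow> L \<and> (\<forall>n\<ge>N. norm (B F n - L) \<le> 6 / \<sigma>\<^sup>2 * M z F N * remainder a b z n) \<and> norm L \<le> M z F N"
proof -
  have shift: "(\<lambda>j. f (N + j)) \<longlonglongrightarrow> l \<longleftrightarrow> f \<longlonglongrightarrow> l" for f :: "nat \<Rightarrow> complex" and l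
    using LIMSEQ_offset[of f N] LIMSEQ_ignore_initial_segment[of f _ N] by (auto simp: add.commute)
  have inc: "norm (A F (N + Suc n) - A F (N + n)) \<le> 6 / \<sigma>\<^sup>2 * \<rho> z (N + n) * (norm (A F (N + n)) + norm (B F (N + n)))"
    "norm (B F (N + Suc n) - B F (N + n)) \<le> 6 / \<sigma>\<^sup>2 * \<rho> z (N + n) * (norm (A F (N + n)) + norm (B F (N + n)))" for n
    using increments[OF F good good, of "N + n"] by (simp_all add: T_def)
  have "\<exists>L. (\<lambda>j. A F (N + j)) \<longlonglongrightarrow> L \<and> (\<forall>n. norm (A F (N + n) - L) \<le> 6 / \<sigma>\<^sup>2 *
      ((norm (A F (N + 0)) + norm (B F (N + 0))) * exp (2 * (6 / \<sigma>\<^sup>2) * (\<Sum>j. \<rho> z (N + j)))) * (\<Sum>j. \<rho> z (N + (n + j))))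
      \<and> norm L \<le> (norm (A F (N + 0)) + norm (B F (N + 0))) * exp (2 * (6 / \<sigma>\<^sup>2) * (\<Sum>j. \<rho> z (N + j)))"
    using inc by (intro limit_of_perturbed_constants summable_rho_shift rho_nonneg) auto
  then obtain L where "A F \<longlonglongrightarrow> L" "norm L \<le> M z F N"
    and L: "\<And>n. norm (A F (N + n) - L) \<le> 6 / \<sigma>\<^sup>2 * M z F N * remainder a b z (N + n)"
    by (auto simp: shift M_def T_def remainder_eq add.assoc add.commute[of "norm (B F _)"])
  moreover have "norm (A F n - L) \<le> 6 / \<sigma>\<^sup>2 * M z F N * remainder a b z n" if "n \<ge> N" for n
    using L[of "n - N"] that by simp
  ultimately show "\<exists>L. A F \<longlonglongrightarrow> L \<and> (\<forall>n\<ge>N. norm (A F n - L) \<le> 6 / \<sigma>\<^sup>2 * M z F N * remainder a b z n) \<and> norm L \<le> M z F N"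
    by blast
  \<comment> \<open>The perturbation lemma speaks about its first sequence only, so it is used again
    with \<open>A\<close> and \<open>B\<close> exchanged.\<close>
  have "\<exists>L. (\<lambda>j. B F (N + j)) \<longlonglongrightarrow> L \<and> (\<forall>n. norm (B F (N + n) - L) \<le> 6 / \<sigma>\<^sup>2 *
      ((norm (B F (N + 0)) + norm (A F (N + 0))) * exp (2 * (6 / \<sigma>\<^sup>2) * (\<Sum>j. \<rho> z (N + j)))) * (\<Sum>j. \<rho> z (N + (n + j))))
      \<and> norm L \<le> (norm (B F (N + 0)) + norm (A F (N + 0))) * exp (2 * (6 / \<sigma>\<^sup>2) * (\<Sum>j. \<rho> z (N + j)))"
    using inc by (intro limit_of_perturbed_constants summable_rho_shift rho_nonneg) (auto simp: add.commute[of "norm (B F _)"])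
  then obtain L where "B F \<longlonglongrightarrow> L" "norm L \<le> M z F N"
    and L: "\<And>n. norm (B F (N + n) - L) \<le> 6 / \<sigma>\<^sup>2 * M z F N * remainder a b z (N + n)"
    by (auto simp: shift M_def T_def remainder_eq add.assoc add.commute[of "norm (B F _)"])
  moreover have "norm (B F n - L) \<le> 6 / \<sigma>\<^sup>2 * M z F N * remainder a b z n" if "n \<ge> N" for n
    using L[of "n - N"] that by simp
  ultimately show "\<exists>L. B F \<longlonglongrightarrow> L \<and> (\<forall>n\<ge>N. norm (B F n - L) \<le> 6 / \<sigma>\<^sup>2 * M z F N * remainder a b z n) \<and> norm L \<le> M z F N"
    by blast
qed

lemma eventually_good_from: "\<exists>N. \<forall>n\<ge>N. good n"
  using eventually_good by (simp add: eventually_sequentially)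

lemma A_limit: "jacobi_recurrence a b z F \<Longrightarrow> A F \<longlonglongrightarrow> lim (A F)"
  and B_limit: "jacobi_recurrence a b z F \<Longrightarrow> B F \<longlonglongrightarrow> lim (B F)"
proof -
  assume F: "jacobi_recurrence a b z F"
  obtain N where N: "\<And>n. n \<ge> N \<Longrightarrow> good n"
    using eventually_good_from by blast
  show "A F \<longlonglongrightarrow> lim (A F)" "B F \<longlonglongrightarrow> lim (B F)"
    using limits_from[OF F N] by (meson convergentI convergent_LIMSEQ_iff order_refl)+
qed

lemma limit_bounds:
  assumes "jacobi_recurrence a b z F" "\<And>m. m \<ge> N \<Longrightarrow> good m"
  shows "n \<ge> N \<Longrightarrow> norm (A F n - lim (A F)) \<le> 6 / \<sigma>\<^sup>2 * M z F N * remainder a b z n"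
    and "n \<ge> N \<Longrightarrow> norm (B F n - lim (B F)) \<le> 6 / \<sigma>\<^sup>2 * M z F N * remainder a b z n"
    and "norm (lim (A F)) \<le> M z F N"
  using limits_from[OF assms] limI by metis+

text \<open>With zero limits the rate estimate started at \<open>n\<close> itself bounds
  \<open>T F n\<close> by a small multiple of \<open>T F n\<close> once the remainder is small. So
  \<open>T F n\<close> vanishes, hence two consecutive values of \<open>F\<close>, and the
  recurrence carries this back to -1.\<close>

lemma limits_0_imp_0:
  assumes F: "jacobi_recurrence a b z F" and 0: "A F \<longlonglongrightarrow> 0" "B F \<longlonglongrightarrow> 0" and "m \<ge> -1"
  shows "F m = 0"
proof -
  let ?R = "remainder a b z"
  \<comment> \<open>This factor arises by adding the rate bounds for \<open>A\<close> and
    \<open>B\<close> and unfolding \<open>M\<close>.\<close>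
  have "(\<lambda>n. 12 / \<sigma>\<^sup>2 * exp (12 / \<sigma>\<^sup>2 * ?R n) * ?R n) \<longlonglongrightarrow> 12 / \<sigma>\<^sup>2 * exp (12 / \<sigma>\<^sup>2 * 0) * 0"
    by (intro tendsto_intros remainder_tendsto)
  then have "\<forall>\<^sub>F n in sequentially. 12 / \<sigma>\<^sup>2 * exp (12 / \<sigma>\<^sup>2 * ?R n) * ?R n < 1"
    by (rule order_tendstoD) simp
  then obtain n where good: "\<And>m. m \<ge> n \<Longrightarrow> good m" and n: "12 / \<sigma>\<^sup>2 * exp (12 / \<sigma>\<^sup>2 * ?R n) * ?R n < 1"
    using eventually_good_from unfolding eventually_sequentially by (meson order.trans nat_le_linear)
  have "T F n \<le> T F n * (12 / \<sigma>\<^sup>2 * exp (12 / \<sigma>\<^sup>2 * ?R n) * ?R n)"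
  proof -
    have "norm (A F n - 0) \<le> 6 / \<sigma>\<^sup>2 * M z F n * ?R n" "norm (B F n - 0) \<le> 6 / \<sigma>\<^sup>2 * M z F n * ?R n"
      using limit_bounds(1,2)[OF F good, of n n] limI[OF 0(1)] limI[OF 0(2)] by simp_all
    then have "T F n \<le> 2 * (6 / \<sigma>\<^sup>2 * M z F n * ?R n)"
      by (simp add: T_def)
    then show ?thesis
      by (simp add: M_def mult_ac)
  qed
  then have "T F n * (1 - 12 / \<sigma>\<^sup>2 * exp (12 / \<sigma>\<^sup>2 * ?R n) * ?R n) \<le> 0"
    by (simp add: algebra_simps)
  with n have "T F n \<le> 0"
    by (simp add: mult_le_0_iff)
  then have "u F n = 0" "u F (Suc n) = 0"
    using u_bounds[OF good[OF order_refl], of F] sigma_pos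
    by (smt (verit) divide_nonpos_pos norm_le_zero_iff)+
  then have "F (int n) = 0" "F (int n + 1) = 0"
    using a_pos[of "int n"] a_pos[of "int n + 1"] by (simp_all add: u_def add.commute)
  then show ?thesis
    using recurrence_eq_0_backward[OF F] \<open>m \<ge> -1\<close> by blast
qed

lemma A_lincomb: "A (\<lambda>n. c * F n + d * G n) = (\<lambda>n. c * A F n + d * A G n)"
  and B_lincomb: "B (\<lambda>n. c * F n + d * G n) = (\<lambda>n. c * B F n + d * B G n)"
  by (simp_all add: A_def B_def u_def algebra_simps fun_eq_iff)

text \<open>Conjugation exchanges the two characteristic roots and so the roles of \<open>A\<close>
  and \<open>B\<close>; the limits for the conjugate Jost solution follow from this.\<close>

lemma A_cnj: "A (\<lambda>n. cnj (F n)) = (\<lambda>n. cnj (B F n))"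
  and B_cnj: "B (\<lambda>n. cnj (F n)) = (\<lambda>n. cnj (A F n))"
  by (simp_all add: A_def B_def u_def fun_eq_iff)

lemma AB_cong:
  assumes "\<And>n. n \<ge> -1 \<Longrightarrow> F n = G n"
  shows "A F = A G" "B F = B G"
  using assms by (simp_all add: A_def B_def u_def fun_eq_iff)

lemma eq_of_limits:
  assumes F: "jacobi_recurrence a b z F" and G: "jacobi_recurrence a b z G"
    and A: "A F \<longlonglongrightarrow> l" "A G \<longlonglongrightarrow> l" and B: "B F \<longlonglongrightarrow> m" "B G \<longlonglongrightarrow> m" and "n \<ge> -1"
  shows "F n = G n"
proof -
  have "1 * F n + (-1) * G n = 0"
  proof (rule limits_0_imp_0[OF jacobi_recurrence_lincomb[OF F G]])
    show "A (\<lambda>n. 1 * F n + (-1) * G n) \<longlonglongrightarrow> 0" "B (\<lambda>n. 1 * F n + (-1) * G n) \<longlonglongrightarrow> 0"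
      unfolding A_lincomb B_lincomb
      using tendsto_diff[OF A] tendsto_diff[OF B] by simp_all
  qed fact
  then show ?thesis by simp
qed

text \<open>The map from initial values to limits is linear and injective, hence surjective.\<close>

lemma solution_with_limits:
  "\<exists>F. jacobi_solution a b z F \<and> A F \<longlonglongrightarrow> l \<and> B F \<longlonglongrightarrow> m"
proof -
  define \<Lambda> where "\<Lambda> = (\<lambda>(p, q). (lim (A (solution z p q)), lim (B (solution z p q))))"
  have lims: "A (solution z p q) \<longlonglongrightarrow> fst (\<Lambda> (p, q))" "B (solution z p q) \<longlonglongrightarrow> snd (\<Lambda> (p, q))" for p q
    using A_limit[OF jacobi_recurrence_solution] B_limit[OF jacobi_recurrence_solution]
    by (simp_all add: \<Lambda>_def)
  have comb: "\<Lambda> (c * p + d * p', c * q + d * q')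
      = (c * fst (\<Lambda> (p, q)) + d * fst (\<Lambda> (p', q')), c * snd (\<Lambda> (p, q)) + d * snd (\<Lambda> (p', q')))" for c d p q p' q'
  proof -
    let ?F = "solution z p q" and ?G = "solution z p' q'"
    have "solution z (c * p + d * p') (c * q + d * q') n = c * ?F n + d * ?G n" if "n \<ge> -1" for n
      by (rule recurrence_unique[OF jacobi_recurrence_solution
            jacobi_recurrence_lincomb[OF jacobi_recurrence_solution jacobi_recurrence_solution]])
         (use that in simp_all)
    then have cong: "A (solution z (c * p + d * p') (c * q + d * q')) = A (\<lambda>n. c * ?F n + d * ?G n)"
      "B (solution z (c * p + d * p') (c * q + d * q')) = B (\<lambda>n. c * ?F n + d * ?G n)"
      by (intro AB_cong; simp)+
    have "A (solution z (c * p + d * p') (c * q + d * q')) \<longlonglongrightarrow> c * fst (\<Lambda> (p, q)) + d * fst (\<Lambda> (p', q'))"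
      "B (solution z (c * p + d * p') (c * q + d * q')) \<longlonglongrightarrow> c * snd (\<Lambda> (p, q)) + d * snd (\<Lambda> (p', q'))"
      unfolding cong A_lincomb B_lincomb by (auto intro!: tendsto_intros lims)
    then show ?thesis
      using limI unfolding \<Lambda>_def by auto
  qed
  \<comment> \<open>Real linearity is enough: domain and codomain are the same finite-dimensional
    real space, so injectivity gives surjectivity.\<close>
  have "linear \<Lambda>"
  proof
    show "\<Lambda> (x + y) = \<Lambda> x + \<Lambda> y" for x y
      using comb[of 1 "fst x" 1 "fst y" "snd x" "snd y"] by (simp add: plus_prod_def)
    show "\<Lambda> (r *\<^sub>R x) = r *\<^sub>R \<Lambda> x" for r x
      using comb[of "of_real r" "fst x" 0 0 "snd x" 0] by (simp add: scaleR_prod_def scaleR_conv_of_real)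
  qed
  moreover have "inj \<Lambda>"
    unfolding linear_injective_0[OF \<open>linear \<Lambda>\<close>]
  proof clarify
    fix p q assume "\<Lambda> (p, q) = 0"
    then have "solution z p q n = 0" if "n \<ge> -1" for n
      using limits_0_imp_0[OF jacobi_recurrence_solution] lims[of p q] that by simp
    from this[of "-1"] this[of 0] show "(p, q) = 0"
      by (simp add: zero_prod_def)
  qed
  ultimately have "surj \<Lambda>"
    by (rule linear_injective_imp_surjective) (rule refl)
  then obtain p q where "\<Lambda> (p, q) = (l, m)"
    by (metis surj_pair surjD)
  then show ?thesis
    using lims[of p q] jacobi_solution_solution[of z p q] by auto
qed

section \<open>The Jost solution and its conjugate\<close>

abbreviation jost_asymptotics :: "(int \<Rightarrow> complex) \<Rightarrow> bool" where
  "jost_asymptotics F \<equiv> (\<lambda>n. F (int n)) \<sim>[sequentially]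
     (\<lambda>n. of_real (1 / sqrt (a (int n))) * exp (- \<i> * of_real (\<phi> n)))"

lemma jost_asymptotics_iff: "jost_asymptotics F \<longleftrightarrow> (\<lambda>n. E n * u F n) \<longlonglongrightarrow> 1"
proof -
  have "F (int n) / (of_real (1 / sqrt (a (int n))) * exp (- \<i> * of_real (\<phi> n))) = E n * u F n" for n
    using a_pos[of "int n"] by (simp add: E_def u_def cis_conv_exp exp_minus field_simps)
  \<comment> \<open>Asymptotic equivalence is defined with the quotient set to 1 where both
    sequences vanish; a nonvanishing reference sequence excludes that case.\<close>
  moreover have "of_real (1 / sqrt (a (int n))) * exp (- \<i> * of_real (\<phi> n)) \<noteq> 0" for n
    using a_pos[of "int n"] by simp
  ultimately show ?thesis
    by (simp add: asymp_equiv_def)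
qed

lemma w_tendsto: "w \<longlonglongrightarrow> Complex \<beta>lim \<sigma>"
  unfolding w_def by (intro tendsto_Complex beta_tendsto S_tendsto)

text \<open>If \<open>E n * u F n\<close> tends to 1, so does its successor, and
  \<open>E_Suc\<close> expresses \<open>A\<close> and, up to a unimodular factor, \<open>B\<close>
  through these two. Conversely, \<open>u_eq\<close> multiplied by \<open>E n\<close> recovers
  \<open>E n * u F n\<close> from \<open>A\<close> and \<open>B\<close>.\<close>

lemma jost_asymptotics_iff_limits:
  assumes F: "jacobi_recurrence a b z F"
  shows "jost_asymptotics F \<longleftrightarrow> A F \<longlonglongrightarrow> - 2 * \<i> * of_real \<sigma> \<and> B F \<longlonglongrightarrow> 0"
  unfolding jost_asymptotics_iff
proof safe
  let ?w = "Complex \<beta>lim \<sigma>"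
  assume lim: "(\<lambda>n. E n * u F n) \<longlonglongrightarrow> 1"
  note lim' = filterlim_compose[OF lim filterlim_Suc]
  have ww: "?w * cnj ?w = 1"
    using beta_lim_less by (simp add: \<sigma>_def complex_eq_iff abs_square_less_1 less_imp_le flip: power2_eq_square)
  have "(\<lambda>n. cnj (w n) * (E (Suc n) * u F (Suc n)) - w n * (E n * u F n)) \<longlonglongrightarrow> cnj ?w * 1 - ?w * 1"
    by (intro tendsto_intros lim lim' w_tendsto)
  moreover have "cnj ?w * 1 - ?w * 1 = - 2 * \<i> * of_real \<sigma>"
    by (simp add: complex_eq_iff)
  moreover have "\<forall>\<^sub>F n in sequentially. A F n = cnj (w n) * (E (Suc n) * u F (Suc n)) - w n * (E n * u F n)"
    using eventually_good
  proof eventually_elim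
    case (elim n)
    have "cnj (w n) * (E (Suc n) * u F (Suc n)) = (w n * cnj (w n)) * (E n * u F (Suc n))"
      by (simp only: E_Suc[OF elim] mult_ac)
    also have "\<dots> = E n * u F (Suc n)"
      by (simp only: w_cnj[OF elim] mult_1)
    finally show ?case
      by (simp only: A_def right_diff_distrib mult.left_commute)
  qed
  ultimately show "A F \<longlonglongrightarrow> - 2 * \<i> * of_real \<sigma>"
    by (simp add: tendsto_cong)
  have "(\<lambda>n. E (Suc n) * u F (Suc n) - (w n * cnj (w n)) * (E n * u F n)) \<longlonglongrightarrow> 1 - (?w * cnj ?w) * 1"
    by (intro tendsto_intros lim lim' w_tendsto)
  \<comment> \<open>Norms are taken because this expression is \<open>B F n\<close> times
    \<open>w n * E n * E n\<close>, which need not converge but has modulus one.\<close>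
  then have "(\<lambda>n. norm (E (Suc n) * u F (Suc n) - (w n * cnj (w n)) * (E n * u F n))) \<longlonglongrightarrow> 0"
    unfolding ww by (simp add: tendsto_norm_zero_iff)
  moreover have "\<forall>\<^sub>F n in sequentially. norm (B F n) = norm (E (Suc n) * u F (Suc n) - (w n * cnj (w n)) * (E n * u F n))"
    using eventually_good
  proof eventually_elim
    case (elim n)
    have "E (Suc n) * u F (Suc n) - (w n * cnj (w n)) * (E n * u F n) = w n * E n * (u F (Suc n) - cnj (w n) * u F n)"
      by (simp add: E_Suc[OF elim] algebra_simps)
    then show ?case
      by (simp add: B_def norm_mult norm_w[OF elim])
  qed
  ultimately show "B F \<longlonglongrightarrow> 0"
    unfolding tendsto_norm_zero_iff[of "B F", symmetric] by (simp add: tendsto_cong)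
next
  assume A: "A F \<longlonglongrightarrow> - 2 * \<i> * of_real \<sigma>" and B: "B F \<longlonglongrightarrow> 0"
  have "(\<lambda>n. E n * (E n * B F n)) \<longlonglongrightarrow> 0"
    by (rule Lim_null_comparison[OF _ tendsto_norm_zero[OF B]]) (simp add: norm_mult)
  then have "(\<lambda>n. (E n * (E n * B F n) - A F n) / (2 * \<i> * of_real (S n)))
      \<longlonglongrightarrow> (0 - (- 2 * \<i> * of_real \<sigma>)) / (2 * \<i> * of_real \<sigma>)"
    using sigma_pos by (intro tendsto_intros A S_tendsto) auto
  moreover have "\<forall>\<^sub>F n in sequentially. E n * u F n = (E n * (E n * B F n) - A F n) / (2 * \<i> * of_real (S n))"
    using eventually_good
  proof eventually_elim
    case (elim n)
    then have "S n > 0" using sigma_pos by (auto simp: good_def)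
    have "E n * (2 * \<i> * of_real (S n) * u F n) = E n * (E n * B F n) - (E n * cnj (E n)) * A F n"
      unfolding u_eq by (simp only: algebra_simps)
    with \<open>S n > 0\<close> show ?case
      by (simp add: field_simps)
  qed
  ultimately show "(\<lambda>n. E n * u F n) \<longlonglongrightarrow> 1"
    using sigma_pos by (simp add: tendsto_cong)
qed

text \<open>Once the asymptotics is restated as a pair of limits, existence is
  \<open>solution_with_limits\<close> and uniqueness is \<open>eq_of_limits\<close>.\<close>

lemma jost:
  shows "jacobi_recurrence a b z (jost a b z)"
    and "A (jost a b z) \<longlonglongrightarrow> - 2 * \<i> * of_real \<sigma>"
    and "B (jost a b z) \<longlonglongrightarrow> 0"
proof -
  let ?P = "\<lambda>f. jacobi_solution a b z f \<and> jost_asymptotics f"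
  have iff: "?P f \<longleftrightarrow> f \<in> extensional {-1..} \<and> jacobi_recurrence a b z f \<and>
      A f \<longlonglongrightarrow> - 2 * \<i> * of_real \<sigma> \<and> B f \<longlonglongrightarrow> 0" for f
    using jost_asymptotics_iff_limits[of z f] by (auto simp: jacobi_solution_iff)
  obtain f where f: "?P f"
    using solution_with_limits[of z "- 2 * \<i> * of_real \<sigma>" 0] iff jacobi_solution_iff by blast
  have "g = f" if "?P g" for g
    using f that unfolding iff by (auto intro!: extensional_eqI[of g f] intro: eq_of_limits[of z g f])
  with f have "?P (jost a b z)"
    unfolding jost_def by (rule theI)
  then show "jacobi_recurrence a b z (jost a b z)"
    "A (jost a b z) \<longlonglongrightarrow> - 2 * \<i> * of_real \<sigma>" "B (jost a b z) \<longlonglongrightarrow> 0"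
    unfolding iff by blast+
qed

lemma conj_jost:
  shows "jacobi_recurrence a b (of_real x) (conj_jost a b (of_real x))"
    and "A (conj_jost a b (of_real x)) \<longlonglongrightarrow> 0"
    and "B (conj_jost a b (of_real x)) \<longlonglongrightarrow> 2 * \<i> * of_real \<sigma>"
proof -
  have eq: "conj_jost a b (of_real x) = (\<lambda>n. cnj (jost a b (of_real x) n))"
    by (simp add: conj_jost_def fun_eq_iff)
  show "jacobi_recurrence a b (of_real x) (conj_jost a b (of_real x))"
    unfolding eq by (intro jacobi_recurrence_cnj jost)
  show "A (conj_jost a b (of_real x)) \<longlonglongrightarrow> 0" "B (conj_jost a b (of_real x)) \<longlonglongrightarrow> 2 * \<i> * of_real \<sigma>"
    unfolding eq A_cnj B_cnj using tendsto_cnj[OF jost(3)] tendsto_cnj[OF jost(2)] by simp_all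
qed

section \<open>The Jost coefficient and the error term\<close>

abbreviation P :: "real \<Rightarrow> int \<Rightarrow> complex" where "P x \<equiv> orth_poly a b (of_real x)"

lemma jacobi_recurrence_P: "jacobi_recurrence a b (of_real x) (P x)"
  by (simp add: orth_poly_eq jacobi_recurrence_solution)

text \<open>The limit of \<open>A\<close> annihilates the conjugate Jost solution and that of
  \<open>B\<close> the Jost solution, so the two limits for \<open>P x\<close> read off the
  coefficients. Since limits determine solutions, the resulting combination is indeed
  \<open>P x\<close>.\<close>

lemma k_plus_eq: "k_plus a b (of_real x) = lim (A (P x)) / (- 2 * \<i> * of_real \<sigma>)"
proof -
  let ?z = "of_real x :: complex"
  let ?f = "jost a b ?z" and ?g = "conj_jost a b ?z"
  let ?c = "- 2 * \<i> * of_real \<sigma> :: complex" and ?d = "2 * \<i> * of_real \<sigma> :: complex"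
  note lims = A_limit[OF jacobi_recurrence_P[of x]] B_limit[OF jacobi_recurrence_P[of x]]
  let ?comb = "\<lambda>k n. fst k * ?f n + snd k * ?g n"
  have nz: "?c \<noteq> 0" "?d \<noteq> 0" using sigma_pos by auto
  have Al: "A (?comb k) \<longlonglongrightarrow> fst k * ?c" and Bl: "B (?comb k) \<longlonglongrightarrow> snd k * ?d" for k
    unfolding A_lincomb B_lincomb
    using tendsto_add[OF tendsto_mult_left[OF jost(2)] tendsto_mult_left[OF conj_jost(2)]]
      tendsto_add[OF tendsto_mult_left[OF jost(3)] tendsto_mult_left[OF conj_jost(3)]]
    by simp_all
  have "(\<forall>n\<ge>-1. P x n = ?comb k n) \<longleftrightarrow> k = (lim (A (P x)) / ?c, lim (B (P x)) / ?d)" for k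
  proof
    assume "\<forall>n\<ge>-1. P x n = ?comb k n"
    then have "A (P x) = A (?comb k)" "B (P x) = B (?comb k)"
      by (intro AB_cong; simp)+
    then have "lim (A (P x)) = fst k * ?c" "lim (B (P x)) = snd k * ?d"
      using limI[OF Al[of k]] limI[OF Bl[of k]] by simp_all
    with nz show "k = (lim (A (P x)) / ?c, lim (B (P x)) / ?d)"
      by (simp add: prod_eq_iff)
  next
    assume k: "k = (lim (A (P x)) / ?c, lim (B (P x)) / ?d)"
    then have "lim (A (P x)) = fst k * ?c" "lim (B (P x)) = snd k * ?d"
      using nz by simp_all
    with Al[of k] Bl[of k] lims have "P x n = ?comb k n" if "n \<ge> -1" for n
      using that
      by (intro eq_of_limits[OF jacobi_recurrence_P jacobi_recurrence_lincomb[OF jost(1) conj_jost(1)]]) auto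
    then show "\<forall>n\<ge>-1. P x n = ?comb k n" by blast
  qed
  then show ?thesis
    by (simp add: k_plus_def jost_coeffs_def)
qed

text \<open>Telescoping bounds all later changes of \<beta> by the remainder; \<open>S_diff\<close>
  transfers this to \<open>S\<close>, and the later index tends to infinity. This pays for replacing
  \<open>S n\<close> by \<sigma>.\<close>

lemma S_limit_bound:
  assumes good: "\<And>m. m \<ge> n \<Longrightarrow> good m"
  shows "\<bar>S n - \<sigma>\<bar> \<le> 2 / \<sigma> * remainder a b z n"
proof -
  have "\<bar>\<beta> m - \<beta> n\<bar> \<le> remainder a b z n" if "m \<ge> n" for m
  proof -
    have "\<bar>\<beta> (n + j) - \<beta> n\<bar> \<le> (\<Sum>i<j. \<rho> z (n + i))" for j
    proof (induction j)
      case (Suc j)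
      have "\<bar>\<beta> (n + j) - \<beta> (Suc (n + j))\<bar> \<le> \<rho> z (n + j)"
        using alpha_pos[of "Suc (n + j)"] by (simp add: \<rho>_def)
      with Suc show ?case by simp
    qed simp
    also have "(\<Sum>i<j. \<rho> z (n + i)) \<le> remainder a b z n" for j
      unfolding remainder_eq by (intro sum_le_suminf summable_rho_shift) (auto simp: rho_nonneg)
    finally show ?thesis
      using that by (metis le_Suc_ex)
  qed
  then have "\<bar>S n - S m\<bar> \<le> 2 / \<sigma> * remainder a b z n" if "m \<ge> n" for m
    using S_diff[OF good good, of n m] that sigma_pos
    by (smt (verit) abs_minus_commute divide_nonneg_pos mult_left_mono order_refl)
  then show ?thesis
    by (intro tendsto_upperbound[OF tendsto_rabs[OF tendsto_diff[OF tendsto_const S_tendsto]]])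
       (auto simp: eventually_sequentially)
qed

text \<open>Obtained by solving the claimed formula for its error term, so that
  \<open>P_eq_r\<close> is an identity and only a bound is left to prove.\<close>

definition r :: "(real \<Rightarrow> real) \<Rightarrow> real \<Rightarrow> nat \<Rightarrow> real" where
  "r \<eta> x n = Re (u (P x) n) / 2 - kappa a b (of_real x) * cos (\<phi> n - \<eta> x)"

lemma P_eq_r:
  "P x (int n) = of_real (2 / sqrt (a (int n)) * (kappa a b (of_real x) * cos (\<phi> n - \<eta> x) + r \<eta> x n))"
proof -
  have "Im (P x (int n)) = 0"
    using orth_poly_real[of "int n" x] by (simp add: complex_eq_iff)
  then show ?thesis
    using a_pos[of "int n"] by (simp add: r_def u_def complex_eq_iff)
qed

text \<open>Both \<open>u (P x) n\<close> and the cosine term are imaginary parts divided by a sine: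
  \<open>A\<close> over \<open>S n\<close> in the first, the limit of \<open>A\<close> over \<sigma>
  in the second. The error thus has two sources, each of the order of the remainder.\<close>

lemma r_bound:
  assumes \<eta>: "is_jost_phase a b \<eta>" and good: "\<And>m. m \<ge> N \<Longrightarrow> good m" and n: "n \<ge> N"
  shows "\<bar>r \<eta> x n\<bar> \<le> 8 / \<sigma> ^ 3 * M (of_real x) (P x) N * remainder a b (of_real x) n"
proof -
  let ?z = "of_real x :: complex"
  let ?R = "remainder a b ?z n" and ?M = "M ?z (P x) N"
  define L where "L = lim (A (P x))"
  define X where "X = cnj (E n) * A (P x) n"
  define Y where "Y = cnj (E n) * L"
  have bounds: "norm (A (P x) n - L) \<le> 6 / \<sigma>\<^sup>2 * ?M * ?R" "norm L \<le> ?M"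
    using limit_bounds(1,3)[OF jacobi_recurrence_P[of x], of N] good n by (auto simp: L_def)
  have S: "\<sigma> / 2 \<le> S n" "S n > 0"
    using good[OF n] sigma_pos by (auto simp: good_def)
  have "A (P x) n = cnj (B (P x) n)"
  proof -
    have "u (P x) m = cnj (u (P x) m)" for m
      using orth_poly_real[of "int m" x] by (simp add: u_def)
    then show ?thesis
      by (simp add: A_def B_def)
  qed
  \<comment> \<open>Reality of \<open>P x\<close> makes \<open>B\<close> the conjugate of
    \<open>A\<close>, so the right side of \<open>u_eq\<close> is -2 i times the imaginary part of
    \<open>X\<close>.\<close>
  then have "2 * \<i> * of_real (S n) * u (P x) n = cnj X - X"
    unfolding u_eq X_def by simp
  then have "S n * Re (u (P x) n) = - Im X"
    by (simp add: complex_eq_iff)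
  then have u: "Re (u (P x) n) = - Im X / S n"
    using S by (simp add: field_simps)
  have "kappa a b ?z * cos (\<phi> n - \<eta> x) = Re (of_real (kappa a b ?z) * cis (\<eta> x) * cnj (E n))"
    by (simp add: E_def cos_diff algebra_simps)
  also have "of_real (kappa a b ?z) * cis (\<eta> x) = k_plus a b ?z"
    using \<eta> by (simp add: is_jost_phase_def cis_conv_exp)
  also have "\<dots> * cnj (E n) = Y / (- 2 * \<i> * of_real \<sigma>)"
    by (simp add: k_plus_eq L_def Y_def)
  also have "Re \<dots> = - Im Y / (2 * \<sigma>)"
    using sigma_pos by (simp add: Re_divide power2_eq_square)
  finally have r: "r \<eta> x n = (Im Y / \<sigma> - Im X / S n) / 2"
    by (simp add: r_def u)
  have XY: "\<bar>Im Y - Im X\<bar> \<le> 6 / \<sigma>\<^sup>2 * ?M * ?R"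
  proof -
    have "\<bar>Im Y - Im X\<bar> \<le> norm (X - Y)"
      using abs_Im_le_cmod[of "X - Y"] by simp
    also have "X - Y = cnj (E n) * (A (P x) n - L)"
      by (simp add: X_def Y_def algebra_simps)
    finally show ?thesis
      using bounds(1) by (simp add: norm_mult)
  qed
  have Y: "\<bar>Im Y\<bar> \<le> ?M"
    using abs_Im_le_cmod[of Y] bounds(2) by (simp add: Y_def norm_mult)
  have S': "\<bar>S n - \<sigma>\<bar> \<le> 2 / \<sigma> * ?R"
    using good n by (intro S_limit_bound) auto
  \<comment> \<open>This splitting separates the convergence error of \<open>A\<close> from that of
    \<open>S\<close>; they contribute 6 and 2 to the constant 8.\<close>
  have "Im Y / \<sigma> - Im X / S n = ((Im Y - Im X) + Im Y * (S n - \<sigma>) / \<sigma>) / S n"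
    using S sigma_pos by (simp add: field_simps)
  moreover have "\<bar>(Im Y - Im X) + Im Y * (S n - \<sigma>) / \<sigma>\<bar> \<le> 6 / \<sigma>\<^sup>2 * ?M * ?R + ?M * (2 / \<sigma> * ?R) / \<sigma>"
  proof -
    have "\<bar>Im Y * (S n - \<sigma>) / \<sigma>\<bar> \<le> ?M * (2 / \<sigma> * ?R) / \<sigma>"
      unfolding abs_mult abs_divide using Y S' sigma_pos
      by (simp only: abs_of_pos) (intro divide_right_mono mult_mono, auto)
    with XY show ?thesis by linarith
  qed
  moreover have "6 / \<sigma>\<^sup>2 * ?M * ?R + ?M * (2 / \<sigma> * ?R) / \<sigma> = 8 / \<sigma>\<^sup>2 * ?M * ?R"
    using sigma_pos by (simp add: power2_eq_square field_simps)
  ultimately have "\<bar>Im Y / \<sigma> - Im X / S n\<bar> \<le> 8 / \<sigma>\<^sup>2 * ?M * ?R / S n"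
    using S divide_right_mono[of _ _ "S n"] by (simp only: abs_divide abs_of_pos less_imp_le)
  \<comment> \<open>Using that \<open>S n\<close> is at least \<sigma> / 2 supplies the third factor
    1 / \<sigma> and a factor 2, which cancels the division by 2 in the formula for
    \<open>r\<close>.\<close>
  also have "\<dots> \<le> 8 / \<sigma>\<^sup>2 * ?M * ?R / (\<sigma> / 2)"
    using S sigma_pos remainder_nonneg[of ?z n] Y
    by (intro divide_left_mono mult_nonneg_nonneg mult_pos_pos) auto
  finally show ?thesis
    unfolding r using sigma_pos by (simp add: power2_eq_square power3_eq_cube field_simps)
qed

text \<open>The starting index \<open>N\<close> depends on the coefficients alone, so x enters the
  constant only through \<open>M\<close>, evaluated at this fixed index.\<close>

lemma r_bound_uniform:
  assumes "is_jost_phase a b \<eta>"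
  shows "\<exists>C N. \<forall>n\<ge>N. \<forall>x. \<bar>x\<bar> \<le> R \<longrightarrow> \<bar>r \<eta> x n\<bar> \<le> C * remainder a b (of_real x) n"
proof -
  obtain N where N: "\<And>n. n \<ge> N \<Longrightarrow> good n"
    using eventually_good_from by blast
  obtain M1 where M1: "\<And>z. norm z \<le> R \<Longrightarrow> norm (orth_poly a b z (int N)) \<le> M1"
    using orth_poly_bounded by blast
  obtain M2 where M2: "\<And>z. norm z \<le> R \<Longrightarrow> norm (orth_poly a b z (int (Suc N))) \<le> M2"
    using orth_poly_bounded by blast
  define U where "U = sqrt (a (int (Suc N))) * M2 + sqrt (a (int N)) * M1"
  \<comment> \<open>The factor 2 accounts for \<open>A\<close> and \<open>B\<close>, each bounded by
    \<open>U\<close>; the remainder at \<open>R\<close> dominates those at all admissible x.\<close>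
  define C where "C = 2 * U * exp (12 / \<sigma>\<^sup>2 * remainder a b (of_real R) N)"
  have M: "M (of_real x) (P x) N \<le> C" if x: "\<bar>x\<bar> \<le> R" for x
  proof -
    have "norm (u (P x) (Suc N)) \<le> sqrt (a (int (Suc N))) * M2"
      "norm (u (P x) N) \<le> sqrt (a (int N)) * M1"
      unfolding u_def norm_mult using M1[of "of_real x"] M2[of "of_real x"] x a_pos[of "int N"] a_pos[of "int (Suc N)"]
      by (auto intro!: mult_mono)
    then have "norm (A (P x) N) \<le> U" "norm (B (P x) N) \<le> U"
      using norm_triangle_ineq4[of "u (P x) (Suc N)" "w N * u (P x) N"]
        norm_triangle_ineq4[of "u (P x) (Suc N)" "cnj (w N) * u (P x) N"]
      by (simp_all add: A_def B_def U_def norm_mult norm_w[OF N])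
    then have "T (P x) N \<le> 2 * U"
      by (simp add: T_def)
    moreover have "remainder a b (of_real x) N \<le> remainder a b (of_real R) N"
      using x by (intro remainder_mono) auto
    then have "exp (12 / \<sigma>\<^sup>2 * remainder a b (of_real x) N) \<le> exp (12 / \<sigma>\<^sup>2 * remainder a b (of_real R) N)"
      by (simp add: mult_left_mono divide_right_mono)
    moreover have "0 \<le> T (P x) N"
      by (simp add: T_def)
    ultimately show ?thesis
      unfolding M_def C_def by (intro mult_mono) auto
  qed
  have "\<bar>r \<eta> x n\<bar> \<le> 8 / \<sigma> ^ 3 * C * remainder a b (of_real x) n" if "n \<ge> N" "\<bar>x\<bar> \<le> R" for x n
  proof -
    have "8 / \<sigma> ^ 3 * M (of_real x) (P x) N * remainder a b (of_real x) n
        \<le> 8 / \<sigma> ^ 3 * C * remainder a b (of_real x) n"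
      using M[OF that(2)] sigma_pos remainder_nonneg by (intro mult_right_mono mult_left_mono) auto
    then show ?thesis
      using r_bound[OF assms N that(1), of x] by linarith
  qed
  then show ?thesis by blast
qed

end

section \<open>The asymptotic formula\<close>

theorem corollary4p5:
  fixes a :: "int \<Rightarrow> real" and b :: "nat \<Rightarrow> real" and \<beta>lim :: real and \<eta> :: "real \<Rightarrow> real"
  assumes "a (-1) = 1 / 2"
    and "\<And>n. n \<ge> 0 \<Longrightarrow> a n > 0"
    and "summable (\<lambda>n::nat. 1 / a (int n))"
    and "beta a b \<longlonglongrightarrow> \<beta>lim"
    and "\<bar>\<beta>lim\<bar> < 1"
    and "summable (\<lambda>n. \<bar>kratio a n - 1\<bar>)"
    and "summable (\<lambda>n. \<bar>beta a b (n + 1) - beta a b n\<bar>)"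
    and "is_jost_phase a b \<eta>"
  shows "\<exists>r :: real \<Rightarrow> nat \<Rightarrow> real.
     (\<forall>x n. orth_poly a b (of_real x) (int n) =
        of_real (2 / sqrt (a (int n)) *
          (kappa a b (of_real x) * cos (phase a b n - \<eta> x) + r x n))) \<and>
     (\<forall>x. r x \<in> O(remainder a b (of_real x))) \<and>
     (\<forall>K. compact K \<longrightarrow>
        (\<exists>C. \<forall>\<^sub>F n in sequentially. \<forall>x\<in>K. \<bar>r x n\<bar> \<le> C * remainder a b (of_real x) n))"
proof -
  interpret jacobi_coefficients a b \<beta>lim
    using assms by unfold_locales
  show ?thesis
  proof (intro exI[of _ "r \<eta>"] conjI allI impI)
    fix x
    \<comment> \<open>The pointwise estimate is the uniform one on the interval of radius
      \<bar>x\<bar>.\<close>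
    obtain C N where "\<And>n. n \<ge> N \<Longrightarrow> \<bar>r \<eta> x n\<bar> \<le> C * remainder a b (of_real x) n"
      using r_bound_uniform[OF assms(8), of "\<bar>x\<bar>"] by blast
    then show "r \<eta> x \<in> O(remainder a b (of_real x))"
      using remainder_nonneg by (intro bigoI[of _ C]) (auto simp: eventually_sequentially)
  next
    fix K :: "real set" assume "compact K"
    then obtain R where R: "\<And>x. x \<in> K \<Longrightarrow> \<bar>x\<bar> \<le> R"
      using compact_imp_bounded by (metis bounded_iff real_norm_def)
    obtain C N where "\<And>n x. n \<ge> N \<Longrightarrow> \<bar>x\<bar> \<le> R \<Longrightarrow> \<bar>r \<eta> x n\<bar> \<le> C * remainder a b (of_real x) n"
      using r_bound_uniform[OF assms(8), of R] by blast
    with R show "\<exists>C. \<forall>\<^sub>F n in sequentially. \<forall>x\<in>K. \<bar>r \<eta> x n\<bar> \<le> C * remainder a b (of_real x) n"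
      unfolding eventually_sequentially by blast
  qed (rule P_eq_r)
qed

end
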